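(* Let $X$ be a topological space and $x_0\in X$. The lasso topology on the fundamental group $\pi_1(X,x_0)$ coincides with the Spanier subgroup topology on $\pi_1(X,x_0)$.
   Context: For an open cover $\mathcal U$ of $X$ and a point $x\in X$, the Spanier subgroup $\pi(\mathcal U,x)$ is the subgroup of $\pi_1(X,x)$ generated by all classes $[\alpha*\beta*\alpha^{-1}]$, where $\alpha$ is a path in $X$ starting at $x$ and $\beta$ is a loop based at $\alpha(1)$ lying in some $U\in\mathcal U$. The Spanier subgroup topology on $\pi_1(X,x_0)$ is the topology having as a basis all left cosets $g\,\pi(\mathcal U,x_0)$, where $g\in\pi_1(X,x_0)$ and $\mathcal U$ is an open cover of $X$. Let $\widetilde X$ be the universal path space: the set of homotopy classes $\langle\alpha\rangle$ (relative to endpoints) of paths $\alpha$ in $X$ starting at $x_0$, with endpoint projection $p:\widetilde X\to X$, $p(\langle\alpha\rangle)=\alpha(1)$. The lasso topology on $\widetilde X$ is the topology with basis the sets $N(\langle\alpha\rangle,\mathcal U,W)$, where $\alpha$ is a path starting at $x_0$, $\mathcal U$ is an open cover of $X$ and $W$ is an open neighbourhood of $\alpha(1)$; here $\langle\gamma\rangle\in N(\langle\alpha\rangle,\mathcal U,W)$ if and only if $\langle\gamma\rangle$ has a representative of the form $\alpha*L*\beta$ with $[L]\in\pi(\mathcal U,\alpha(1))$ and $\beta$ a path in $W$ starting at $\alpha(1)$. Identifying $\pi_1(X,x_0)$ with the fibre $p^{-1}(x_0)\subseteq\widetilde X$, the lasso topology on $\pi_1(X,x_0)$ is the subspace topology inherited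 from $\widetilde X$ with the lasso topology. *)

theory Defs
  imports "HOL-Analysis.Analysis" "HOL-Algebra.Generated_Groups"
begin

text \<open>
  The library's \<open>homotopic_paths\<close>, \<open>joinpaths\<close> and \<open>reversepath\<close> require the carrier type to be
  in class \<open>topological_space\<close>. The following are their counterparts for an arbitrary
  \<^typ>\<open>'a topology\<close>; as in the library, paths are functions \<^typ>\<open>real \<Rightarrow> 'a\<close> of which only the
  values on \<open>[0,1]\<close> matter.
\<close>

definition path_homotopic :: "'a topology \<Rightarrow> (real \<Rightarrow> 'a) \<Rightarrow> (real \<Rightarrow> 'a) \<Rightarrow> bool" where
  "path_homotopic X p q \<longleftrightarrow>
     homotopic_with (\<lambda>r. r 0 = p 0 \<and> r 1 = p 1) (top_of_set {0..1}) X p q"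

definition path_join :: "(real \<Rightarrow> 'a) \<Rightarrow> (real \<Rightarrow> 'a) \<Rightarrow> real \<Rightarrow> 'a" (infixr \<open>\<star>\<close> 75) where
  "p \<star> q = (\<lambda>t. if t \<le> 1/2 then p (2 * t) else q (2 * t - 1))"

definition path_reverse :: "(real \<Rightarrow> 'a) \<Rightarrow> real \<Rightarrow> 'a" where
  "path_reverse p = (\<lambda>t. p (1 - t))"

definition path_class :: "'a topology \<Rightarrow> (real \<Rightarrow> 'a) \<Rightarrow> (real \<Rightarrow> 'a) set" where
  "path_class X p = {q. path_homotopic X p q}"

definition loop_at :: "'a topology \<Rightarrow> 'a \<Rightarrow> (real \<Rightarrow> 'a) \<Rightarrow> bool" where
  "loop_at X x p \<longleftrightarrow> pathin X p \<and> p 0 = x \<and> p 1 = x"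

definition fundamental_group :: "'a topology \<Rightarrow> 'a \<Rightarrow> (real \<Rightarrow> 'a) set monoid" where
  "fundamental_group X x =
     \<lparr>carrier = {path_class X p | p. loop_at X x p},
      monoid.mult = (\<lambda>A B. \<Union>p\<in>A. \<Union>q\<in>B. path_class X (p \<star> q)),
      one = path_class X (\<lambda>_. x)\<rparr>"

definition open_cover :: "'a topology \<Rightarrow> 'a set set \<Rightarrow> bool" where
  "open_cover X \<U> \<longleftrightarrow> (\<forall>U\<in>\<U>. openin X U) \<and> \<Union>\<U> = topspace X"

definition spanier_subgroup :: "'a topology \<Rightarrow> 'a set set \<Rightarrow> 'a \<Rightarrow> (real \<Rightarrow> 'a) set set" where
  "spanier_subgroup X \<U> x =
     generate (fundamental_group X x)
       {path_class X (\<alpha> \<star> \<beta> \<star> path_reverse \<alpha>) | \<alpha> \<beta> U.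
          pathin X \<alpha> \<and> \<alpha> 0 = x \<and> loop_at X (\<alpha> 1) \<beta> \<and> U \<in> \<U> \<and> \<beta> ` {0..1} \<subseteq> U}"

text \<open>
  The open sets of a topology given by a basis are the unions of basic sets; \<open>topology\<close> is
  meaningful only if these do form a topology, which holds for both families below.
\<close>

definition spanier_topology :: "'a topology \<Rightarrow> 'a \<Rightarrow> (real \<Rightarrow> 'a) set topology" where
  "spanier_topology X x0 =
     topology (arbitrary union_of
       (\<lambda>S. \<exists>g \<U>. g \<in> carrier (fundamental_group X x0) \<and> open_cover X \<U> \<and>
              S = g <#\<^bsub>fundamental_group X x0\<^esub> spanier_subgroup X \<U> x0))"

definition path_space :: "'a topology \<Rightarrow> 'a \<Rightarrow> (real \<Rightarrow> 'a) set set" where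
  "path_space X x0 = {path_class X \<alpha> | \<alpha>. pathin X \<alpha> \<and> \<alpha> 0 = x0}"

definition endpoint :: "(real \<Rightarrow> 'a) set \<Rightarrow> 'a" where
  "endpoint c = the_elem ((\<lambda>\<alpha>. \<alpha> 1) ` c)"

definition lasso_nbhd ::
    "'a topology \<Rightarrow> (real \<Rightarrow> 'a) \<Rightarrow> 'a set set \<Rightarrow> 'a set \<Rightarrow> (real \<Rightarrow> 'a) set set" where
  "lasso_nbhd X \<alpha> \<U> W =
     {path_class X (\<alpha> \<star> L \<star> \<beta>) | L \<beta>.
        loop_at X (\<alpha> 1) L \<and> path_class X L \<in> spanier_subgroup X \<U> (\<alpha> 1) \<and>
        pathin X \<beta> \<and> \<beta> 0 = \<alpha> 1 \<and> \<beta> ` {0..1} \<subseteq> W}"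

definition lasso_topology :: "'a topology \<Rightarrow> 'a \<Rightarrow> (real \<Rightarrow> 'a) set topology" where
  "lasso_topology X x0 =
     topology (arbitrary union_of
       (\<lambda>S. \<exists>\<alpha> \<U> W. pathin X \<alpha> \<and> \<alpha> 0 = x0 \<and> open_cover X \<U> \<and>
              openin X W \<and> \<alpha> 1 \<in> W \<and> S = lasso_nbhd X \<alpha> \<U> W))"

text \<open>
  Elements of the fundamental group and of the path space are the same kind of object (sets of
  paths), so the identification of the group with the fibre of \<^const>\<open>endpoint\<close> over \<open>x0\<close> is
  literal equality of sets.
\<close>

definition lasso_topology_group :: "'a topology \<Rightarrow> 'a \<Rightarrow> (real \<Rightarrow> 'a) set topology" where
  "lasso_topology_group X x0 =
     subtopology (lasso_topology X x0) {c \<in> path_space X x0. endpoint c = x0}"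

end

theory Submission
  imports Defs
begin

text \<open>
  A basic lasso neighbourhood consists of the classes \<open>a \<odot> s \<odot> b\<close>, where \<open>a\<close> is the centre, \<open>s\<close>
  lies in the Spanier subgroup of the cover \<open>\<U>\<close> at the end of \<open>a\<close>, and \<open>b\<close> is represented by a
  path in \<open>W\<close>. The key point is that every element \<open>c = a \<odot> s \<odot> b\<close> is again a centre of the same
  neighbourhood (\<open>lasso_ball_recentre\<close>). Indeed, Spanier subgroups at different base points are
  carried into each other by conjugation with paths (\<open>spanier_subgroup_conj\<close>), so that a lasso
  \<open>t\<close> at the end of \<open>c\<close> can be pulled back along \<open>b\<close>:
  \<open>c \<odot> t \<odot> e = a \<odot> (s \<odot> b \<odot> t \<odot> b\<inverse>) \<odot> (b \<odot> e)\<close>. It follows that these neighbourhoods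
  are a base: an intersection of two of them contains, around each of its points, the
  neighbourhood for the common refinement of the covers.

  Now intersect with the fibre over \<open>x0\<close>, that is, with the fundamental group. A neighbourhood
  centred at \<open>g\<close> in the fibre contains the coset of \<open>g\<close> (take \<open>b\<close> trivial). If moreover \<open>W\<close>
  is a member of the cover that contains \<open>x0\<close>, then the end piece \<open>b\<close> of an element of the fibre
  is a loop in a member of the cover, hence itself an element of the Spanier subgroup, and the trace
  of the neighbourhood is exactly the coset (\<open>coset_eq_lasso_ball\<close>). So cosets are open in the
  subspace topology, and each open set of the subspace contains a coset around each of its points.

  All calculations take place in the fundamental groupoid. Associativity, units and inverses
  are instances of a single fact, \<open>path_homotopic_reparam\<close>: two reparametrisations
  of a path with the same ends are homotopic.
\<close>

section \<open>Homotopies of paths in an abstract topological space\<close>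

lemma path_homotopic_ends:
  assumes "path_homotopic X p q"
  shows "q 0 = p 0" "q 1 = p 1"
  using homotopic_with_imp_property[OF assms[unfolded path_homotopic_def]] by simp_all

lemma path_homotopic_refl: "path_homotopic X p p \<longleftrightarrow> pathin X p"
  by (simp add: path_homotopic_def pathin_def)

lemma path_homotopic_sym:
  assumes "path_homotopic X p q" shows "path_homotopic X q p"
  using assms path_homotopic_ends[OF assms]
  unfolding path_homotopic_def by (simp add: homotopic_with_symD)

lemma path_homotopic_trans:
  assumes "path_homotopic X p q" "path_homotopic X q r" shows "path_homotopic X p r"
  using assms path_homotopic_ends[OF assms(1)]
  unfolding path_homotopic_def by (auto intro: homotopic_with_trans)

text \<open>
  The interval is convex, so the straight-line homotopy between the two parameter functions
  stays inside it; composing with \<open>p\<close> gives the homotopy in \<open>X\<close>.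
\<close>

lemma path_homotopic_reparam:
  assumes p: "pathin X p"
    and f: "continuous_on {0..1} f" "f \<in> {0..1} \<rightarrow> {0..1}"
    and g: "continuous_on {0..1} g" "g \<in> {0..1} \<rightarrow> {0..1}"
    and "f 0 = g 0" "f 1 = g 1"
  shows "path_homotopic X (\<lambda>t. p (f t)) (\<lambda>t. p (g t))"
proof -
  have "homotopic_paths {0..1} f g"
  proof (rule homotopic_paths_linear)
    show "closed_segment (f t) (g t) \<subseteq> {0..1}" if "t \<in> {0..1}" for t
      using that f(2) g(2) by (intro closed_segment_subset) auto
  qed (use assms in \<open>auto simp: path_def pathstart_def pathfinish_def\<close>)
  then have "homotopic_with (\<lambda>r. r 0 = p (f 0) \<and> r 1 = p (f 1)) (top_of_set {0..1}) X (p \<circ> f) (p \<circ> g)"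
    unfolding homotopic_paths_def
    by (rule homotopic_with_compose_continuous_map_left)
       (use p in \<open>auto simp: pathin_def pathstart_def pathfinish_def\<close>)
  then show ?thesis
    by (simp add: path_homotopic_def o_def)
qed

lemma path_homotopic_join:
  assumes "path_homotopic X p p'" "path_homotopic X q q'" "p 1 = q 0"
  shows "path_homotopic X (p \<star> q) (p' \<star> q')"
proof -
  let ?I2 = "prod_topology (top_of_set {0..1::real}) (top_of_set {0..1::real})"
  obtain h where h: "continuous_map ?I2 X h" "\<And>x. h (0, x) = p x" "\<And>x. h (1, x) = p' x"
      and h01: "\<And>s. s \<in> {0..1} \<Longrightarrow> h (s, 0) = p 0 \<and> h (s, 1) = p 1"
    using assms(1) unfolding path_homotopic_def homotopic_with_def by auto
  obtain k where k: "continuous_map ?I2 X k" "\<And>x. k (0, x) = q x" "\<And>x. k (1, x) = q' x"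
      and k01: "\<And>s. s \<in> {0..1} \<Longrightarrow> k (s, 0) = q 0 \<and> k (s, 1) = q 1"
    using assms(2) unfolding path_homotopic_def homotopic_with_def by auto
  define H where "H = (\<lambda>z::real \<times> real. if snd z \<le> 1/2 then (h \<circ> (\<lambda>z. (fst z, 2 * snd z))) z
                       else (k \<circ> (\<lambda>z. (fst z, 2 * snd z - 1))) z)"
  have "continuous_map ?I2 X H"
    unfolding H_def
  proof (rule continuous_map_cases_le)
    show "continuous_map ?I2 euclideanreal snd"
      using continuous_map_snd continuous_map_in_subtopology by blast
    show "continuous_map (subtopology ?I2 {z \<in> topspace ?I2. snd z \<le> 1/2}) X (h \<circ> (\<lambda>z. (fst z, 2 * snd z)))"
      by (rule continuous_map_compose[OF _ h(1)])
         (auto simp: continuous_map_in_subtopology prod_topology_subtopology subtopology_subtopology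
               intro!: continuous_intros)
    show "continuous_map (subtopology ?I2 {z \<in> topspace ?I2. 1/2 \<le> snd z}) X (k \<circ> (\<lambda>z. (fst z, 2 * snd z - 1)))"
      by (rule continuous_map_compose[OF _ k(1)])
         (auto simp: continuous_map_in_subtopology prod_topology_subtopology subtopology_subtopology
               intro!: continuous_intros)
    show "(h \<circ> (\<lambda>z. (fst z, 2 * snd z))) z = (k \<circ> (\<lambda>z. (fst z, 2 * snd z - 1))) z"
      if "z \<in> topspace ?I2" "snd z = 1/2" for z
    proof -
      have "fst z \<in> {0..1}" "2 * snd z = 1" using that by auto
      then show ?thesis using h01 k01 assms(3) by simp
    qed
  qed auto
  then show ?thesis
    unfolding path_homotopic_def homotopic_with_def path_join_def
    by (intro exI[of _ H]) (auto simp: H_def h k h01 k01)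
qed

lemma path_homotopic_reverse:
  assumes "path_homotopic X p q"
  shows "path_homotopic X (path_reverse p) (path_reverse q)"
proof -
  have "homotopic_with (\<lambda>r. r 0 = p 1 \<and> r 1 = p 0) (top_of_set {0..1}) X (p \<circ> (\<lambda>t. 1 - t)) (q \<circ> (\<lambda>t. 1 - t))"
    by (rule homotopic_with_compose_continuous_map_right[OF assms[unfolded path_homotopic_def]])
       (auto intro!: continuous_intros)
  then show ?thesis
    by (simp add: path_homotopic_def path_reverse_def o_def)
qed

lemma pathin_join: "pathin X p \<Longrightarrow> pathin X q \<Longrightarrow> p 1 = q 0 \<Longrightarrow> pathin X (p \<star> q)"
  using path_homotopic_join[of X p p q q] by (simp add: path_homotopic_refl)

lemma pathin_reverse: "pathin X p \<Longrightarrow> pathin X (path_reverse p)"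
  using path_homotopic_reverse[of X p p] by (simp add: path_homotopic_refl)

lemma path_join_ends [simp]: "(p \<star> q) 0 = p 0" "(p \<star> q) 1 = q 1"
  by (auto simp: path_join_def)

lemma path_reverse_ends [simp]: "path_reverse p 0 = p 1" "path_reverse p 1 = p 0"
  by (auto simp: path_reverse_def)

lemma path_reverse_reverse [simp]: "path_reverse (path_reverse p) = p"
  by (simp add: path_reverse_def)

lemma path_join_image_subset:
  assumes "p ` {0..1} \<subseteq> W" "q ` {0..1} \<subseteq> W"
  shows "(p \<star> q) ` {0..1} \<subseteq> W"
  using assms by (auto simp: path_join_def image_subset_iff)

lemma path_reverse_image_subset:
  assumes "p ` {0..1} \<subseteq> W"
  shows "path_reverse p ` {0..1} \<subseteq> W"
  using assms by (auto simp: path_reverse_def image_subset_iff)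

lemma path_homotopic_assoc:
  assumes "pathin X p" "pathin X q" "pathin X r" "p 1 = q 0" "q 1 = r 0"
  shows "path_homotopic X ((p \<star> q) \<star> r) (p \<star> (q \<star> r))"
proof -
  \<comment> \<open>The two bracketings run through the same three paths at different
    speeds. The change of parameter has slopes \<open>2\<close>, \<open>1\<close>, \<open>1/2\<close>; these decrease, so it is a minimum of linear functions and its continuity is immediate.\<close>
  define f where "f = (\<lambda>t::real. min (2 * t) (min (t + 1/4) ((t + 1) / 2)))"
  have eq: "(p \<star> q) \<star> r = (\<lambda>t. (p \<star> (q \<star> r)) (f t))"
  proof
    fix t :: real
    consider "t \<le> 1/4" | "1/4 < t" "t \<le> 1/2" | "1/2 < t" by linarith
    then show "((p \<star> q) \<star> r) t = (p \<star> (q \<star> r)) (f t)"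
    proof cases
      case 1
      then have "f t = 2 * t" by (auto simp: f_def)
      with 1 show ?thesis by (simp add: path_join_def)
    next
      case 2
      then have "f t = t + 1/4" by (auto simp: f_def)
      with 2 show ?thesis by (simp add: path_join_def algebra_simps)
    next
      case 3
      then have "f t = (t + 1) / 2" by (auto simp: f_def)
      with 3 show ?thesis by (simp add: path_join_def algebra_simps)
    qed
  qed
  have "path_homotopic X (\<lambda>t. (p \<star> (q \<star> r)) (f t)) (\<lambda>t. (p \<star> (q \<star> r)) t)"
    by (rule path_homotopic_reparam)
       (auto simp: f_def pathin_join assms min_le_iff_disj intro!: continuous_intros)
  then show ?thesis by (simp add: eq)
qed

lemma path_homotopic_unit_left:
  assumes "pathin X p" shows "path_homotopic X ((\<lambda>_. p 0) \<star> p) p"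
proof -
  have "path_homotopic X (\<lambda>t. p (max 0 (2 * t - 1))) (\<lambda>t. p t)"
    by (rule path_homotopic_reparam[OF assms]) (auto intro!: continuous_intros)
  moreover have "(\<lambda>_. p 0) \<star> p = (\<lambda>t. p (max 0 (2 * t - 1)))"
  proof
    have "max 0 (2 * t - 1) = (if t \<le> 1/2 then 0 else 2 * t - 1)" for t :: real
      by auto
    then show "((\<lambda>_. p 0) \<star> p) t = p (max 0 (2 * t - 1))" for t
      by (simp add: path_join_def)
  qed
  ultimately show ?thesis by simp
qed

lemma path_homotopic_unit_right:
  assumes "pathin X p" shows "path_homotopic X (p \<star> (\<lambda>_. p 1)) p"
proof -
  have "path_homotopic X (\<lambda>t. p (min (2 * t) 1)) (\<lambda>t. p t)"
    by (rule path_homotopic_reparam[OF assms]) (auto intro!: continuous_intros)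
  moreover have "p \<star> (\<lambda>_. p 1) = (\<lambda>t. p (min (2 * t) 1))"
    by (auto simp: path_join_def min_def)
  ultimately show ?thesis by simp
qed

lemma path_homotopic_inverse_right:
  assumes "pathin X p" shows "path_homotopic X (p \<star> path_reverse p) (\<lambda>_. p 0)"
proof -
  \<comment> \<open>Running along \<open>p\<close> and back is \<open>p\<close> after a tent function, which takes the value \<open>0\<close> at both ends.\<close>
  have "path_homotopic X (\<lambda>t. p (min (2 * t) (2 - 2 * t))) (\<lambda>t. p ((\<lambda>_. 0) t))"
    by (rule path_homotopic_reparam[OF assms]) (auto intro!: continuous_intros)
  moreover have "p \<star> path_reverse p = (\<lambda>t. p (min (2 * t) (2 - 2 * t)))"
    by (auto simp: path_join_def path_reverse_def min_def fun_eq_iff)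
  ultimately show ?thesis by simp
qed

section \<open>The groupoid of path classes\<close>

lemma path_class_eqI:
  assumes pq: "path_homotopic X p q"
  shows "path_class X p = path_class X q"
  unfolding path_class_def
  using path_homotopic_trans[OF pq] path_homotopic_trans[OF path_homotopic_sym[OF pq]] by blast

text \<open>
  The counterpart of \<^const>\<open>endpoint\<close>. With both available as functions of the class,
  composability of classes is an equation, and the groupoid laws become conditional rewrite
  rules whose side conditions mention no further variables.
\<close>

definition startpoint :: "(real \<Rightarrow> 'a) set \<Rightarrow> 'a" where
  "startpoint c = the_elem ((\<lambda>\<alpha>. \<alpha> 0) ` c)"

lemma path_class_ends:
  assumes "pathin X p"
  shows "startpoint (path_class X p) = p 0" "endpoint (path_class X p) = p 1"
proof -
  have p: "p \<in> path_class X p"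
    using assms by (simp add: path_class_def path_homotopic_refl)
  have "(\<lambda>\<alpha>. \<alpha> 0) ` path_class X p = {p 0}" "(\<lambda>\<alpha>. \<alpha> 1) ` path_class X p = {p 1}"
    using p path_homotopic_ends
    by (force simp: path_class_def)+
  then show "startpoint (path_class X p) = p 0" "endpoint (path_class X p) = p 1"
    by (auto simp: startpoint_def endpoint_def)
qed

context
  fixes X :: "'a topology"
begin

definition arrow :: "(real \<Rightarrow> 'a) set \<Rightarrow> bool" where
  "arrow A \<longleftrightarrow> (\<exists>p. pathin X p \<and> A = path_class X p)"

text \<open>
  The group operation of \<^const>\<open>fundamental_group\<close>, at every base point, is this formula. It is
  the groupoid composition only for classes with matching ends.
\<close>

definition class_mult :: "(real \<Rightarrow> 'a) set \<Rightarrow> (real \<Rightarrow> 'a) set \<Rightarrow> (real \<Rightarrow> 'a) set"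
    (infixr \<open>\<odot>\<close> 75) where
  "A \<odot> B = (\<Union>p\<in>A. \<Union>q\<in>B. path_class X (p \<star> q))"

definition class_inv :: "(real \<Rightarrow> 'a) set \<Rightarrow> (real \<Rightarrow> 'a) set" where
  "class_inv A = path_reverse ` A"

definition class_unit :: "'a \<Rightarrow> (real \<Rightarrow> 'a) set" where
  "class_unit x = path_class X (\<lambda>_. x)"

lemma arrow_path_class [simp]: "pathin X p \<Longrightarrow> arrow (path_class X p)"
  by (auto simp: arrow_def)

lemma arrowE:
  assumes "arrow A"
  obtains p where "pathin X p" "A = path_class X p" "startpoint A = p 0" "endpoint A = p 1"
  using assms path_class_ends unfolding arrow_def by metis

lemma class_mult_path_class:
  assumes "pathin X p" "pathin X q" "p 1 = q 0"
  shows "path_class X p \<odot> path_class X q = path_class X (p \<star> q)"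
proof -
  have "path_class X (p' \<star> q') = path_class X (p \<star> q)"
    if "p' \<in> path_class X p" "q' \<in> path_class X q" for p' q'
    using that assms path_class_eqI[OF path_homotopic_join[of X p p' q q']]
    by (simp add: path_class_def)
  moreover have "p \<in> path_class X p" "q \<in> path_class X q"
    using assms by (auto simp: path_class_def path_homotopic_refl)
  ultimately show ?thesis
    unfolding class_mult_def by blast
qed

lemma class_inv_path_class:
  "class_inv (path_class X p) = path_class X (path_reverse p)"
proof (intro subset_antisym subsetI)
  fix q assume "q \<in> class_inv (path_class X p)"
  then show "q \<in> path_class X (path_reverse p)"
    by (auto simp: class_inv_def path_class_def intro: path_homotopic_reverse)
next
  fix q assume "q \<in> path_class X (path_reverse p)"
  then have "path_reverse q \<in> path_class X p"
    using path_homotopic_reverse[of X "path_reverse p" q] by (simp add: path_class_def)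
  then show "q \<in> class_inv (path_class X p)"
    unfolding class_inv_def by (rule rev_image_eqI) simp
qed

lemma pathin_const: "x \<in> topspace X \<Longrightarrow> pathin X (\<lambda>_. x)"
  by (simp add: pathin_def)

lemma arrow_class_mult [simp]:
  assumes "arrow A" "arrow B" "endpoint A = startpoint B"
  shows "arrow (A \<odot> B)" "startpoint (A \<odot> B) = startpoint A" "endpoint (A \<odot> B) = endpoint B"
  using assms
  by (auto elim!: arrowE simp: class_mult_path_class path_class_ends pathin_join)

lemma arrow_class_inv [simp]:
  assumes "arrow A"
  shows "arrow (class_inv A)" "startpoint (class_inv A) = endpoint A"
    "endpoint (class_inv A) = startpoint A"
  using assms
  by (auto elim!: arrowE simp: class_inv_path_class path_class_ends pathin_reverse)

lemma arrow_class_unit [simp]: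
  assumes "x \<in> topspace X"
  shows "arrow (class_unit x)" "startpoint (class_unit x) = x" "endpoint (class_unit x) = x"
  using assms by (auto simp: class_unit_def pathin_const path_class_ends)

lemma arrow_ends_in_topspace [simp]:
  assumes "arrow A" shows "startpoint A \<in> topspace X" "endpoint A \<in> topspace X"
  using assms by (auto elim!: arrowE simp: path_start_in_topspace path_finish_in_topspace)

lemma class_mult_assoc [simp]:
  assumes "arrow A" "arrow B" "arrow C" "endpoint A = startpoint B" "endpoint B = startpoint C"
  shows "(A \<odot> B) \<odot> C = A \<odot> (B \<odot> C)"
proof -
  obtain p q r where "pathin X p" "A = path_class X p" "pathin X q" "B = path_class X q"
      "pathin X r" "C = path_class X r"
    using assms by (metis arrowE)
  with assms show ?thesis
    by (simp add: class_mult_path_class pathin_join path_class_ends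
          path_class_eqI[OF path_homotopic_assoc])
qed

lemma class_mult_unit [simp]:
  assumes "arrow A"
  shows "startpoint A = x \<Longrightarrow> class_unit x \<odot> A = A" "endpoint A = x \<Longrightarrow> A \<odot> class_unit x = A"
proof -
  obtain p where p: "pathin X p" "A = path_class X p" "startpoint A = p 0" "endpoint A = p 1"
    using assms by (rule arrowE)
  then have "pathin X (\<lambda>_. p 0)" "pathin X (\<lambda>_. p 1)"
    by (auto intro: pathin_const path_start_in_topspace path_finish_in_topspace)
  with p show "startpoint A = x \<Longrightarrow> class_unit x \<odot> A = A" "endpoint A = x \<Longrightarrow> A \<odot> class_unit x = A"
    by (auto simp: class_unit_def class_mult_path_class
          path_class_eqI[OF path_homotopic_unit_left] path_class_eqI[OF path_homotopic_unit_right])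
qed

lemma class_inv_inv [simp]: "class_inv (class_inv A) = A"
  by (simp add: class_inv_def image_image)

lemma class_inv_unit [simp]: "class_inv (class_unit x) = class_unit x"
  by (simp add: class_unit_def class_inv_path_class path_reverse_def)

lemma class_mult_inv_right [simp]:
  assumes "arrow A" shows "A \<odot> class_inv A = class_unit (startpoint A)"
proof -
  obtain p where "pathin X p" "A = path_class X p" "startpoint A = p 0" "endpoint A = p 1"
    using assms by (rule arrowE)
  then show ?thesis
    by (simp add: class_unit_def class_mult_path_class class_inv_path_class pathin_reverse
          path_class_eqI[OF path_homotopic_inverse_right])
qed

lemma class_mult_inv_left [simp]:
  assumes "arrow A" shows "class_inv A \<odot> A = class_unit (endpoint A)"
  using class_mult_inv_right[of "class_inv A"] assms by simp

lemma class_mult_cancel_left [simp]: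
  assumes "arrow A" "arrow B"
  shows "endpoint A = startpoint B \<Longrightarrow> class_inv A \<odot> (A \<odot> B) = B"
    "startpoint A = startpoint B \<Longrightarrow> A \<odot> (class_inv A \<odot> B) = B"
  using class_mult_assoc[of "class_inv A" A B] class_mult_assoc[of A "class_inv A" B] assms
  by (simp_all del: class_mult_assoc)

text \<open>
  Both sides are inverse to \<open>A \<odot> B\<close>, and inverses in a groupoid are unique.
\<close>

lemma class_inv_mult [simp]:
  assumes "arrow A" "arrow B" "endpoint A = startpoint B"
  shows "class_inv (A \<odot> B) = class_inv B \<odot> class_inv A"
proof -
  have "class_inv (A \<odot> B) = class_inv (A \<odot> B) \<odot> ((A \<odot> B) \<odot> (class_inv B \<odot> class_inv A))"
    using assms by simp
  also have "\<dots> = class_inv B \<odot> class_inv A"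
    using assms by (simp del: class_mult_assoc)
  finally show ?thesis .
qed

section \<open>The fundamental group and its Spanier subgroups\<close>

lemma mem_carrier_fundamental_group:
  "A \<in> carrier (fundamental_group X x) \<longleftrightarrow> arrow A \<and> startpoint A = x \<and> endpoint A = x"
  by (auto simp: fundamental_group_def loop_at_def path_class_ends elim!: arrowE)

lemma mult_fundamental_group [simp]: "A \<otimes>\<^bsub>fundamental_group X x\<^esub> B = A \<odot> B"
  by (simp add: fundamental_group_def class_mult_def)

lemma one_fundamental_group [simp]: "\<one>\<^bsub>fundamental_group X x\<^esub> = class_unit x"
  by (simp add: fundamental_group_def class_unit_def)

lemma group_fundamental_group:
  assumes "x \<in> topspace X" shows "group (fundamental_group X x)"
proof (rule groupI)
  show "\<exists>B\<in>carrier (fundamental_group X x). B \<otimes>\<^bsub>fundamental_group X x\<^esub> A = \<one>\<^bsub>fundamental_group X x\<^esub>"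
    if "A \<in> carrier (fundamental_group X x)" for A
    using that by (intro bexI[of _ "class_inv A"]) (auto simp: mem_carrier_fundamental_group)
qed (use assms in \<open>auto simp: mem_carrier_fundamental_group\<close>)

lemma inv_fundamental_group:
  assumes "x \<in> topspace X" "A \<in> carrier (fundamental_group X x)"
  shows "inv\<^bsub>fundamental_group X x\<^esub> A = class_inv A"
  using assms by (intro group.inv_equality group_fundamental_group)
     (auto simp: mem_carrier_fundamental_group)

abbreviation lassos :: "'a set set \<Rightarrow> 'a \<Rightarrow> (real \<Rightarrow> 'a) set set" where
  "lassos \<U> x \<equiv> {path_class X (\<alpha> \<star> \<beta> \<star> path_reverse \<alpha>) | \<alpha> \<beta> U.
          pathin X \<alpha> \<and> \<alpha> 0 = x \<and> loop_at X (\<alpha> 1) \<beta> \<and> U \<in> \<U> \<and> \<beta> ` {0..1} \<subseteq> U}"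

text \<open>
  The tails of the generators may range over arbitrary arrows instead of paths; in this form
  conjugating a lasso only lengthens its tail.
\<close>

lemma lassos_eq:
  "lassos \<U> x = {A \<odot> path_class X \<beta> \<odot> class_inv A | A \<beta> U.
     arrow A \<and> startpoint A = x \<and> loop_at X (endpoint A) \<beta> \<and> U \<in> \<U> \<and> \<beta> ` {0..1} \<subseteq> U}"
  (is "_ = ?R")
proof -
  have *: "path_class X (\<alpha> \<star> \<beta> \<star> path_reverse \<alpha>) =
           path_class X \<alpha> \<odot> path_class X \<beta> \<odot> class_inv (path_class X \<alpha>)"
    if "pathin X \<alpha>" "loop_at X (\<alpha> 1) \<beta>" for \<alpha> \<beta>
    using that
    by (simp add: class_inv_path_class class_mult_path_class pathin_join pathin_reverse loop_at_def)
  show ?thesis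
  proof (intro subset_antisym subsetI)
    fix c assume "c \<in> lassos \<U> x"
    then obtain \<alpha> \<beta> U where "pathin X \<alpha>" "\<alpha> 0 = x" "loop_at X (\<alpha> 1) \<beta>" "U \<in> \<U>" "\<beta> ` {0..1} \<subseteq> U"
        "c = path_class X (\<alpha> \<star> \<beta> \<star> path_reverse \<alpha>)"
      by blast
    then show "c \<in> ?R"
      using * by (intro CollectI exI[of _ "path_class X \<alpha>"] exI[of _ \<beta>] exI[of _ U])
         (simp add: path_class_ends)
  next
    fix c assume "c \<in> ?R"
    then obtain A \<beta> U where A: "arrow A" "startpoint A = x" "loop_at X (endpoint A) \<beta>" "U \<in> \<U>"
        "\<beta> ` {0..1} \<subseteq> U" "c = A \<odot> path_class X \<beta> \<odot> class_inv A"
      by blast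
    from A(1) obtain \<alpha> where "pathin X \<alpha>" "A = path_class X \<alpha>" "startpoint A = \<alpha> 0" "endpoint A = \<alpha> 1"
      by (rule arrowE)
    with A * show "c \<in> lassos \<U> x"
      by (intro CollectI exI[of _ \<alpha>] exI[of _ \<beta>] exI[of _ U]) simp
  qed
qed

lemma lassos_subset_carrier: "lassos \<U> x \<subseteq> carrier (fundamental_group X x)"
  unfolding lassos_eq
  by (auto simp: mem_carrier_fundamental_group loop_at_def path_class_ends)

lemma subgroup_spanier:
  "x \<in> topspace X \<Longrightarrow> subgroup (spanier_subgroup X \<U> x) (fundamental_group X x)"
  unfolding spanier_subgroup_def
  by (intro group.generate_is_subgroup group_fundamental_group lassos_subset_carrier)

lemma spanier_subgroup_arrow:
  assumes "x \<in> topspace X" "s \<in> spanier_subgroup X \<U> x"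
  shows "arrow s" "startpoint s = x" "endpoint s = x"
  using subgroup.mem_carrier[OF subgroup_spanier[OF assms(1)] assms(2)]
  by (simp_all add: mem_carrier_fundamental_group)

lemma spanier_subgroup_closed:
  assumes "x \<in> topspace X"
  shows "class_unit x \<in> spanier_subgroup X \<U> x"
    and "s \<in> spanier_subgroup X \<U> x \<Longrightarrow> t \<in> spanier_subgroup X \<U> x \<Longrightarrow> s \<odot> t \<in> spanier_subgroup X \<U> x"
    and "s \<in> spanier_subgroup X \<U> x \<Longrightarrow> class_inv s \<in> spanier_subgroup X \<U> x"
  using subgroup.one_closed[OF subgroup_spanier[OF assms]]
    subgroup.m_closed[OF subgroup_spanier[OF assms]]
    subgroup.m_inv_closed[OF subgroup_spanier[OF assms]]
    subgroup.mem_carrier[OF subgroup_spanier[OF assms]]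
  by (auto simp: inv_fundamental_group[OF assms])

text \<open>
  A small loop is a lasso with constant tail.
\<close>

lemma lasso_in_spanier_subgroup:
  assumes "loop_at X x \<beta>" "U \<in> \<U>" "\<beta> ` {0..1} \<subseteq> U"
  shows "path_class X \<beta> \<in> spanier_subgroup X \<U> x"
proof -
  have x: "x \<in> topspace X"
    using assms(1) path_start_in_topspace by (auto simp: loop_at_def)
  then have "class_unit x \<odot> path_class X \<beta> \<odot> class_inv (class_unit x) = path_class X \<beta>"
    using assms(1) by (simp add: loop_at_def path_class_ends)
  with assms x have "path_class X \<beta> \<in> lassos \<U> x"
    unfolding lassos_eq
    by (intro CollectI exI[of _ "class_unit x"] exI[of _ \<beta>] exI[of _ U]) simp
  then show ?thesis
    unfolding spanier_subgroup_def by (rule generate.incl)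
qed

text \<open>
  Conjugation with \<open>b\<close> is a homomorphism between the fundamental groups at the ends of \<open>b\<close>, and it
  maps lassos to lassos because \<open>b\<close> can be prepended to the tail.
\<close>

lemma spanier_subgroup_conj:
  assumes b: "arrow b" "startpoint b = x" "endpoint b = y"
    and "s \<in> spanier_subgroup X \<U> y"
  shows "b \<odot> s \<odot> class_inv b \<in> spanier_subgroup X \<U> x"
proof -
  have x: "x \<in> topspace X" and y: "y \<in> topspace X"
    using b by auto
  have lasso: "b \<odot> h \<odot> class_inv b \<in> lassos \<U> x" if "h \<in> lassos \<U> y" for h
  proof -
    from that obtain A \<beta> U where A: "arrow A" "startpoint A = y" "loop_at X (endpoint A) \<beta>" "U \<in> \<U>"
        "\<beta> ` {0..1} \<subseteq> U" "h = A \<odot> path_class X \<beta> \<odot> class_inv A"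
      unfolding lassos_eq by blast
    then have "b \<odot> h \<odot> class_inv b = (b \<odot> A) \<odot> path_class X \<beta> \<odot> class_inv (b \<odot> A)"
      using b by (simp add: loop_at_def path_class_ends)
    with A b show ?thesis
      unfolding lassos_eq
      by (intro CollectI exI[of _ "b \<odot> A"] exI[of _ \<beta>] exI[of _ U]) simp
  qed
  from assms(4) show ?thesis
    unfolding spanier_subgroup_def
  proof (induction rule: generate.induct)
    case one
    then show ?case
      using b generate.one[of "fundamental_group X x"] by simp
  next
    case (incl h)
    then show ?case
      by (intro generate.incl lasso)
  next
    case (inv h)
    then have h: "h \<in> carrier (fundamental_group X y)"
      using lassos_subset_carrier by blast
    have "b \<odot> h \<odot> class_inv b \<in> carrier (fundamental_group X x)"
      using lasso[OF inv] lassos_subset_carrier by blast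
    then have "inv\<^bsub>fundamental_group X x\<^esub> (b \<odot> h \<odot> class_inv b) = b \<odot> class_inv h \<odot> class_inv b"
      using b h x by (simp add: inv_fundamental_group mem_carrier_fundamental_group)
    with generate.inv[OF lasso[OF inv], of "fundamental_group X x"] show ?case
      using h y by (simp add: inv_fundamental_group)
  next
    case (eng h k)
    then have hk: "arrow h" "startpoint h = y" "endpoint h = y" "arrow k" "startpoint k = y" "endpoint k = y"
      using group.generate_in_carrier[OF group_fundamental_group[OF y] lassos_subset_carrier]
      by (auto simp: mem_carrier_fundamental_group)
    have "(b \<odot> h \<odot> class_inv b) \<odot> (b \<odot> k \<odot> class_inv b) = b \<odot> (h \<odot> k) \<odot> class_inv b"
      using b hk by simp
    with generate.eng[OF eng.IH] show ?case by simp
  qed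
qed

lemma spanier_subgroup_refine:
  assumes "x \<in> topspace X" "\<And>V. V \<in> \<V> \<Longrightarrow> \<exists>U\<in>\<U>. V \<subseteq> U"
  shows "spanier_subgroup X \<V> x \<subseteq> spanier_subgroup X \<U> x"
  unfolding spanier_subgroup_def
proof (rule group.mono_generate[OF group_fundamental_group[OF assms(1)]], rule subsetI)
  fix c assume "c \<in> lassos \<V> x"
  then obtain \<alpha> \<beta> V where c: "pathin X \<alpha>" "\<alpha> 0 = x" "loop_at X (\<alpha> 1) \<beta>" "\<beta> ` {0..1} \<subseteq> V"
      "c = path_class X (\<alpha> \<star> \<beta> \<star> path_reverse \<alpha>)" and "V \<in> \<V>"
    by blast
  then obtain U where "U \<in> \<U>" "\<beta> ` {0..1} \<subseteq> U"
    using assms(2)[of V] by blast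
  with c show "c \<in> lassos \<U> x"
    by (intro CollectI exI[of _ \<alpha>] exI[of _ \<beta>] exI[of _ U]) simp
qed

section \<open>Basic neighbourhoods of the lasso topology\<close>

definition path_classes_in :: "'a set \<Rightarrow> (real \<Rightarrow> 'a) set set" where
  "path_classes_in W = {path_class X \<beta> | \<beta>. pathin X \<beta> \<and> \<beta> ` {0..1} \<subseteq> W}"

lemma path_classes_in_arrow: "b \<in> path_classes_in W \<Longrightarrow> arrow b"
  by (auto simp: path_classes_in_def)

lemma path_classes_in_mono: "W \<subseteq> W' \<Longrightarrow> path_classes_in W \<subseteq> path_classes_in W'"
  by (fastforce simp: path_classes_in_def)

lemma path_classes_in_unit: "x \<in> topspace X \<Longrightarrow> x \<in> W \<Longrightarrow> class_unit x \<in> path_classes_in W"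
  using pathin_const by (fastforce simp: path_classes_in_def class_unit_def)

lemma path_classes_in_mult:
  assumes "a \<in> path_classes_in W" "b \<in> path_classes_in W" "endpoint a = startpoint b"
  shows "a \<odot> b \<in> path_classes_in W"
proof -
  obtain p q where "pathin X p" "p ` {0..1} \<subseteq> W" "a = path_class X p"
      "pathin X q" "q ` {0..1} \<subseteq> W" "b = path_class X q"
    using assms by (auto simp: path_classes_in_def)
  with assms(3) show ?thesis
    unfolding path_classes_in_def
    by (intro CollectI exI[of _ "p \<star> q"])
       (simp add: path_class_ends class_mult_path_class pathin_join path_join_image_subset)
qed

lemma path_classes_in_inv: "b \<in> path_classes_in W \<Longrightarrow> class_inv b \<in> path_classes_in W"
  unfolding path_classes_in_def
  by (auto simp: class_inv_path_class) (metis pathin_reverse path_reverse_image_subset)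

lemma path_classes_in_endpoint: "b \<in> path_classes_in W \<Longrightarrow> endpoint b \<in> W"
  by (auto simp: path_classes_in_def path_class_ends)

text \<open>
  The set \<^const>\<open>lasso_nbhd\<close> expressed by classes instead of representatives.
\<close>

definition lasso_ball :: "(real \<Rightarrow> 'a) set \<Rightarrow> 'a set set \<Rightarrow> 'a set \<Rightarrow> (real \<Rightarrow> 'a) set set" where
  "lasso_ball a \<U> W = {a \<odot> s \<odot> b | s b. s \<in> spanier_subgroup X \<U> (endpoint a) \<and>
     b \<in> path_classes_in W \<and> startpoint b = endpoint a}"

lemma lasso_nbhd_eq_ball:
  assumes \<alpha>: "pathin X \<alpha>"
  shows "lasso_nbhd X \<alpha> \<U> W = lasso_ball (path_class X \<alpha>) \<U> W"
proof (intro subset_antisym subsetI)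
  fix c assume "c \<in> lasso_nbhd X \<alpha> \<U> W"
  then obtain L \<beta> where "loop_at X (\<alpha> 1) L" "path_class X L \<in> spanier_subgroup X \<U> (\<alpha> 1)"
      "pathin X \<beta>" "\<beta> 0 = \<alpha> 1" "\<beta> ` {0..1} \<subseteq> W" "c = path_class X (\<alpha> \<star> L \<star> \<beta>)"
    unfolding lasso_nbhd_def by blast
  with \<alpha> show "c \<in> lasso_ball (path_class X \<alpha>) \<U> W"
    unfolding lasso_ball_def path_classes_in_def
    by (intro CollectI exI[of _ "path_class X L"] exI[of _ "path_class X \<beta>"])
       (auto simp: class_mult_path_class pathin_join loop_at_def path_class_ends)
next
  fix c assume "c \<in> lasso_ball (path_class X \<alpha>) \<U> W"
  then obtain s b where c: "c = path_class X \<alpha> \<odot> s \<odot> b" and s: "s \<in> spanier_subgroup X \<U> (\<alpha> 1)"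
      and b: "b \<in> path_classes_in W" "startpoint b = \<alpha> 1"
    using \<alpha> by (auto simp: lasso_ball_def path_class_ends)
  have "\<alpha> 1 \<in> topspace X" using \<alpha> path_finish_in_topspace by blast
  note s' = spanier_subgroup_arrow[OF this s]
  then obtain L where L: "pathin X L" "s = path_class X L" "L 0 = \<alpha> 1" "L 1 = \<alpha> 1"
    by (metis arrowE)
  obtain \<beta> where \<beta>: "pathin X \<beta>" "b = path_class X \<beta>" "\<beta> ` {0..1} \<subseteq> W"
    using b by (auto simp: path_classes_in_def)
  with b have "\<beta> 0 = \<alpha> 1" by (simp add: path_class_ends)
  with \<alpha> c s L \<beta> show "c \<in> lasso_nbhd X \<alpha> \<U> W"
    unfolding lasso_nbhd_def
    by (intro CollectI exI[of _ L] exI[of _ \<beta>])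
       (auto simp: class_mult_path_class pathin_join loop_at_def)
qed

lemma lasso_ball_centre:
  assumes "arrow a" "endpoint a \<in> W" shows "a \<in> lasso_ball a \<U> W"
  unfolding lasso_ball_def
  using assms
  by (intro CollectI exI[of _ "class_unit (endpoint a)"])
     (auto simp: spanier_subgroup_closed path_classes_in_unit)

lemma lasso_ball_mono:
  assumes "arrow a" "W \<subseteq> W'" "\<And>V. V \<in> \<V> \<Longrightarrow> \<exists>U\<in>\<U>. V \<subseteq> U"
  shows "lasso_ball a \<V> W \<subseteq> lasso_ball a \<U> W'"
proof -
  have "spanier_subgroup X \<V> (endpoint a) \<subseteq> spanier_subgroup X \<U> (endpoint a)"
    using assms(1,3) by (intro spanier_subgroup_refine) auto
  then show ?thesis
    using path_classes_in_mono[OF assms(2)] unfolding lasso_ball_def by blast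
qed

text \<open>
  One half of the recentring argument. That \<open>a\<close> lies in the ball about \<open>c\<close> is recorded too, since
  it allows the lemma to be applied a second time with \<open>a\<close> and \<open>c\<close> exchanged, which gives the
  reverse inclusion.
\<close>

lemma lasso_ball_recentre_subset:
  assumes a: "arrow a" and c: "c \<in> lasso_ball a \<U> W"
  shows "arrow c \<and> startpoint c = startpoint a \<and> endpoint c \<in> W \<and> a \<in> lasso_ball c \<U> W
       \<and> lasso_ball c \<U> W \<subseteq> lasso_ball a \<U> W"
proof -
  obtain s b where c_eq: "c = a \<odot> s \<odot> b" and s: "s \<in> spanier_subgroup X \<U> (endpoint a)"
      and b: "b \<in> path_classes_in W" "startpoint b = endpoint a"
    using c by (auto simp: lasso_ball_def)
  have ea: "endpoint a \<in> topspace X" using a by simp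
  note s' = spanier_subgroup_arrow[OF ea s] and b' = path_classes_in_arrow[OF b(1)]
  have c': "arrow c" "startpoint c = startpoint a" "endpoint c = endpoint b"
    using c_eq a s' b' b by auto
  have "a \<in> lasso_ball c \<U> W"
    unfolding lasso_ball_def
  proof (intro CollectI exI conjI)
    \<comment> \<open>Solve \<open>c = a \<odot> s \<odot> b\<close> for \<open>a\<close> and move \<open>s\<inverse>\<close> to the end of \<open>b\<close> by conjugation.\<close>
    show "a = c \<odot> (class_inv b \<odot> class_inv s \<odot> class_inv (class_inv b)) \<odot> class_inv b"
      using c_eq a s' b' b by simp
    show "class_inv b \<odot> class_inv s \<odot> class_inv (class_inv b) \<in> spanier_subgroup X \<U> (endpoint c)"
      using c' b' b s ea by (intro spanier_subgroup_conj) (auto intro: spanier_subgroup_closed)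
  qed (use b b' c' in \<open>auto intro: path_classes_in_inv\<close>)
  moreover have "lasso_ball c \<U> W \<subseteq> lasso_ball a \<U> W"
  proof
    fix d assume "d \<in> lasso_ball c \<U> W"
    then obtain t e where d: "d = c \<odot> t \<odot> e" and t: "t \<in> spanier_subgroup X \<U> (endpoint b)"
      and e: "e \<in> path_classes_in W" "startpoint e = endpoint b"
      using c' by (auto simp: lasso_ball_def)
    have "endpoint b \<in> topspace X" using b' by simp
    note t' = spanier_subgroup_arrow[OF this t] and e' = path_classes_in_arrow[OF e(1)]
    show "d \<in> lasso_ball a \<U> W"
      unfolding lasso_ball_def
    proof (intro CollectI exI conjI)
      \<comment> \<open>The lasso \<open>t\<close> is based at the end of \<open>b\<close>; inserting \<open>b\<inverse> \<odot> b\<close> moves it to the end of \<open>a\<close>.\<close>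
      show "d = a \<odot> (s \<odot> (b \<odot> t \<odot> class_inv b)) \<odot> (b \<odot> e)"
        using d c_eq a s' b' b t' e' e by simp
      show "s \<odot> (b \<odot> t \<odot> class_inv b) \<in> spanier_subgroup X \<U> (endpoint a)"
        using s t b b' ea by (intro spanier_subgroup_closed spanier_subgroup_conj) auto
    qed (use b b' e e' in \<open>auto intro: path_classes_in_mult\<close>)
  qed
  ultimately show ?thesis
    using c' path_classes_in_endpoint[OF b(1)] by simp
qed

lemma lasso_ball_recentre:
  assumes "arrow a" "c \<in> lasso_ball a \<U> W"
  shows "arrow c" "startpoint c = startpoint a" "endpoint c \<in> W" "lasso_ball c \<U> W = lasso_ball a \<U> W"
proof -
  have c: "arrow c" "a \<in> lasso_ball c \<U> W" and
    "startpoint c = startpoint a" "endpoint c \<in> W" "lasso_ball c \<U> W \<subseteq> lasso_ball a \<U> W"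
    using lasso_ball_recentre_subset[OF assms] by simp_all
  moreover have "lasso_ball a \<U> W \<subseteq> lasso_ball c \<U> W"
    using lasso_ball_recentre_subset[OF c] by simp
  ultimately show "arrow c" "startpoint c = startpoint a" "endpoint c \<in> W"
      "lasso_ball c \<U> W = lasso_ball a \<U> W"
    by simp_all
qed

lemma open_cover_meet:
  assumes "open_cover X \<U>" "open_cover X \<V>"
  shows "open_cover X {U \<inter> V | U V. U \<in> \<U> \<and> V \<in> \<V>}"
proof -
  have "\<Union>{U \<inter> V | U V. U \<in> \<U> \<and> V \<in> \<V>} = \<Union>\<U> \<inter> \<Union>\<V>"
    by blast
  with assms show ?thesis
    unfolding open_cover_def by (auto intro: openin_Int)
qed

text \<open>
  The base of \<^const>\<open>lasso_topology\<close>, with centres taken among the classes.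
\<close>

definition basic_lasso_ball :: "'a \<Rightarrow> (real \<Rightarrow> 'a) set set \<Rightarrow> bool" where
  "basic_lasso_ball x S \<longleftrightarrow> (\<exists>a \<U> W. arrow a \<and> startpoint a = x \<and> open_cover X \<U> \<and>
     openin X W \<and> endpoint a \<in> W \<and> S = lasso_ball a \<U> W)"

text \<open>
  The base condition is immediate from recentring: at a common point \<open>c\<close> both members may be
  taken to be balls about \<open>c\<close>, and then refining the covers and intersecting the open
  sets gives a smaller ball about \<open>c\<close>.
\<close>

lemma openin_lasso_topology:
  "openin (lasso_topology X x) = arbitrary union_of basic_lasso_ball x"
proof -
  have "(\<exists>\<alpha> \<U> W. pathin X \<alpha> \<and> \<alpha> 0 = x \<and> open_cover X \<U> \<and> openin X W \<and> \<alpha> 1 \<in> W \<and>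
      S = lasso_nbhd X \<alpha> \<U> W) \<longleftrightarrow> basic_lasso_ball x S" for S
    unfolding basic_lasso_ball_def
    by (metis arrowE arrow_path_class lasso_nbhd_eq_ball path_class_ends)
  moreover have "istopology (arbitrary union_of basic_lasso_ball x)"
    unfolding istopology_base_eq
  proof (intro allI impI, elim conjE)
    fix S T assume "basic_lasso_ball x S" "basic_lasso_ball x T"
    then obtain a \<U> W a' \<U>' W'
      where a: "arrow a" "startpoint a = x" "open_cover X \<U>" "openin X W" "S = lasso_ball a \<U> W"
        and a': "arrow a'" "open_cover X \<U>'" "openin X W'" "T = lasso_ball a' \<U>' W'"
      unfolding basic_lasso_ball_def by metis
    let ?\<V> = "{U \<inter> V | U V. U \<in> \<U> \<and> V \<in> \<U>'}"
    show "(arbitrary union_of basic_lasso_ball x) (S \<inter> T)"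
      unfolding arbitrary_union_of_alt
    proof
      fix c assume "c \<in> S \<inter> T"
      with a a' have c: "arrow c" "startpoint c = x" "endpoint c \<in> W \<inter> W'"
          and S: "S = lasso_ball c \<U> W" and T: "T = lasso_ball c \<U>' W'"
        using lasso_ball_recentre[of a c \<U> W] lasso_ball_recentre[of a' c \<U>' W'] by auto
      have "basic_lasso_ball x (lasso_ball c ?\<V> (W \<inter> W'))"
        unfolding basic_lasso_ball_def using a a' c open_cover_meet by blast
      moreover have "lasso_ball c ?\<V> (W \<inter> W') \<subseteq> S" "lasso_ball c ?\<V> (W \<inter> W') \<subseteq> T"
        unfolding S T using c(1) by (intro lasso_ball_mono; blast)+
      ultimately show "\<exists>U. basic_lasso_ball x U \<and> c \<in> U \<and> U \<subseteq> S \<inter> T"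
        using lasso_ball_centre[OF c(1,3), of ?\<V>] by blast
    qed
  qed
  ultimately show ?thesis
    unfolding lasso_topology_def by (simp add: topology_inverse')
qed

section \<open>Lasso balls and cosets of Spanier subgroups\<close>

lemma fibre_eq_carrier:
  "{c \<in> path_space X x. endpoint c = x} = carrier (fundamental_group X x)"
proof -
  have "c \<in> path_space X x \<longleftrightarrow> arrow c \<and> startpoint c = x" for c
  proof
    assume "c \<in> path_space X x"
    then obtain \<alpha> where "pathin X \<alpha>" "\<alpha> 0 = x" "c = path_class X \<alpha>"
      unfolding path_space_def by blast
    then show "arrow c \<and> startpoint c = x"
      by (simp add: path_class_ends)
  next
    assume c: "arrow c \<and> startpoint c = x"
    then have "arrow c" by simp
    then obtain \<alpha> where "pathin X \<alpha>" "c = path_class X \<alpha>" "startpoint c = \<alpha> 0" "endpoint c = \<alpha> 1"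
      by (rule arrowE)
    with c show "c \<in> path_space X x"
      unfolding path_space_def by (intro CollectI exI[of _ \<alpha>]) simp
  qed
  then show ?thesis
    by (simp add: set_eq_iff mem_carrier_fundamental_group conj_assoc)
qed

lemma coset_subset_lasso_ball:
  assumes "g \<in> carrier (fundamental_group X x)" "x \<in> W"
  shows "g <#\<^bsub>fundamental_group X x\<^esub> spanier_subgroup X \<U> x
           \<subseteq> lasso_ball g \<U> W \<inter> carrier (fundamental_group X x)"
proof
  fix c assume "c \<in> g <#\<^bsub>fundamental_group X x\<^esub> spanier_subgroup X \<U> x"
  then obtain s where s: "s \<in> spanier_subgroup X \<U> x" "c = g \<odot> s"
    by (auto simp: l_coset_def)
  have g: "arrow g" "startpoint g = x" "endpoint g = x"
    using assms(1) by (auto simp: mem_carrier_fundamental_group)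
  then have x: "x \<in> topspace X" by auto
  note s' = spanier_subgroup_arrow[OF x s(1)]
  have "c \<in> lasso_ball g \<U> W"
    unfolding lasso_ball_def
    using s s' g x assms(2)
    by (intro CollectI exI[of _ s] exI[of _ "class_unit x"]) (auto simp: path_classes_in_unit)
  then show "c \<in> lasso_ball g \<U> W \<inter> carrier (fundamental_group X x)"
    using s s' g by (auto simp: mem_carrier_fundamental_group)
qed

text \<open>
  When the open set is a member of the cover, the end piece of a ball element that returns to
  \<open>x\<close> is a loop in that member, so it is absorbed by the Spanier subgroup.
\<close>

lemma coset_eq_lasso_ball:
  assumes g: "g \<in> carrier (fundamental_group X x)" and "x \<in> U" "U \<in> \<U>"
  shows "lasso_ball g \<U> U \<inter> carrier (fundamental_group X x)
           = g <#\<^bsub>fundamental_group X x\<^esub> spanier_subgroup X \<U> x"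
proof (intro subset_antisym subsetI)
  fix c assume c: "c \<in> lasso_ball g \<U> U \<inter> carrier (fundamental_group X x)"
  have g': "arrow g" "startpoint g = x" "endpoint g = x"
    using g by (auto simp: mem_carrier_fundamental_group)
  then have x: "x \<in> topspace X" by auto
  from c g' obtain s b where s: "s \<in> spanier_subgroup X \<U> x" "c = g \<odot> s \<odot> b"
      and b: "b \<in> path_classes_in U" "startpoint b = x"
    by (auto simp: lasso_ball_def)
  note s' = spanier_subgroup_arrow[OF x s(1)] and b' = path_classes_in_arrow[OF b(1)]
  have "endpoint b = x"
    using c s s' b b' g' by (auto simp: mem_carrier_fundamental_group)
  with b have "b \<in> spanier_subgroup X \<U> x"
    using lasso_in_spanier_subgroup[OF _ assms(3)]
    by (auto simp: path_classes_in_def path_class_ends loop_at_def)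
  then have "s \<odot> b \<in> spanier_subgroup X \<U> x"
    using s x by (intro spanier_subgroup_closed)
  then show "c \<in> g <#\<^bsub>fundamental_group X x\<^esub> spanier_subgroup X \<U> x"
    using s by (auto simp: l_coset_def)
qed (use coset_subset_lasso_ball[OF assms(1,2)] in blast)

end

theorem proposition3p5:
  fixes X :: "'a topology" and x0 :: 'a
  assumes "x0 \<in> topspace X"
  shows "lasso_topology_group X x0 = spanier_topology X x0"
proof -
  let ?G = "fundamental_group X x0"
  have "spanier_topology X x0 = subtopology (lasso_topology X x0) (carrier ?G)"
    unfolding spanier_topology_def
  proof (rule topology_base_unique)
    fix S assume "\<exists>g \<U>. g \<in> carrier ?G \<and> open_cover X \<U> \<and> S = g <#\<^bsub>?G\<^esub> spanier_subgroup X \<U> x0"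
    then obtain g \<U> where g: "g \<in> carrier ?G" "open_cover X \<U>" and S: "S = g <#\<^bsub>?G\<^esub> spanier_subgroup X \<U> x0"
      by blast
    obtain U where U: "U \<in> \<U>" "x0 \<in> U"
      using g(2) assms by (auto simp: open_cover_def)
    have "arrow X g" "startpoint g = x0" "endpoint g = x0" "openin X U"
      using g U by (simp_all add: mem_carrier_fundamental_group open_cover_def)
    then have "basic_lasso_ball X x0 (lasso_ball X g \<U> U)"
      unfolding basic_lasso_ball_def using g U
      by (intro exI[of _ g] exI[of _ \<U>] exI[of _ U]) simp
    then have "openin (lasso_topology X x0) (lasso_ball X g \<U> U)"
      by (simp add: openin_lasso_topology arbitrary_union_of_inc)
    then show "openin (subtopology (lasso_topology X x0) (carrier ?G)) S"
      using S coset_eq_lasso_ball[OF g(1) U(2,1)] unfolding openin_subtopology by blast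
  next
    fix S c assume "openin (subtopology (lasso_topology X x0) (carrier ?G)) S" "c \<in> S"
    then obtain T where T: "openin (lasso_topology X x0) T" and S: "S = T \<inter> carrier ?G"
        and c: "c \<in> T" "c \<in> carrier ?G"
      by (auto simp: openin_subtopology)
    obtain B where "basic_lasso_ball X x0 B" "c \<in> B" "B \<subseteq> T"
      using T c unfolding openin_lasso_topology arbitrary_union_of_alt by blast
    then obtain a \<U> W where a: "arrow X a" "open_cover X \<U>" "c \<in> lasso_ball X a \<U> W" "lasso_ball X a \<U> W \<subseteq> T"
      unfolding basic_lasso_ball_def by blast
    have c': "arrow X c" "endpoint c = x0" "x0 \<in> W" "lasso_ball X c \<U> W \<subseteq> T"
      using a(4) c(2) lasso_ball_recentre[OF a(1,3)] by (simp_all add: mem_carrier_fundamental_group)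
    have "c <#\<^bsub>?G\<^esub> spanier_subgroup X \<U> x0 \<subseteq> S"
      using coset_subset_lasso_ball[OF c(2) c'(3), of \<U>] c'(4) S by blast
    moreover have "c \<in> c <#\<^bsub>?G\<^esub> spanier_subgroup X \<U> x0"
      unfolding l_coset_def
      using spanier_subgroup_closed(1)[OF assms, of \<U>] c'(1,2)
      by (intro UN_I[of "class_unit X x0"]) simp_all
    ultimately show "\<exists>B. (\<exists>g \<U>. g \<in> carrier ?G \<and> open_cover X \<U> \<and> B = g <#\<^bsub>?G\<^esub> spanier_subgroup X \<U> x0)
          \<and> c \<in> B \<and> B \<subseteq> S"
      using c(2) a(2) by blast
  qed
  then show ?thesis
    unfolding lasso_topology_group_def fibre_eq_carrier by simp
qed

end
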